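(* Let $m\in\mathbb{N}$ and let $\mathbf{P}$ be a set of unary and binary predicates. A first-order interpretation $\mathcal{I}$ over the signature $\mathbf{P}\uplus\{\mathtt{F},\mathtt{L}_0,\dots,\mathtt{L}_{m-1}\}$ (no constants) satisfies $\phi^m_{\mathrm{stack}}$ if and only if $\mathcal{I}$ is isomorphic to the stacked interpretation $\mathcal{I}^{\mathfrak{M}}$ of some standpoint structure $\mathfrak{M}$ over $\langle\mathbf{P},\emptyset,\{*\}\rangle$ with $2^m$ precisifications.
   Context: A standpoint structure over $\langle\mathbf{P},\emptyset,\{*\}\rangle$ is $\mathfrak{M}=\langle\Delta,\Pi,\sigma,\gamma\rangle$ with nonempty domain $\Delta$, nonempty set of precisifications $\Pi$, $\sigma( * )=\Pi$, and $\gamma(\pi)$ an interpretation of $\mathbf{P}$ over $\Delta$ for each $\pi$. Stacked interpretation: if $|\Pi|=2^m$ and $\Pi$ is linearly ordered as $\pi_0,\dots,\pi_{2^m-1}$, then $\mathcal{I}^{\mathfrak{M}}$ is the first-order interpretation over $\mathbf{P}\uplus\{\mathtt{F},\mathtt{L}_0,\dots,\mathtt{L}_{m-1}\}$ ($\mathtt{F}$ fresh binary, $\mathtt{L}_j$ fresh unary) with domain $\Delta\times\{0,\dots,2^m-1\}$, $\mathtt{L}_j^{\mathcal{I}}=\{(\delta,i)\mid$ the bit of weight $2^j$ in the binary encoding of $i$ is $1\}$, $\mathtt{F}^{\mathcal{I}}=\{((\delta,i),(\delta,i+1))\mid\delta\in\Delta,0\le i<2^m-1\}$, $P^{\mathcal{I}}=\bigcup_{0\le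 i<2^m}P^{\gamma(\pi_i)}\times\{i\}$ for unary $P\in\mathbf{P}$, and $P^{\mathcal{I}}=\{((\delta_1,i),(\delta_2,i))\mid 0\le i<2^m,(\delta_1,\delta_2)\in P^{\gamma(\pi_i)}\}$ for binary $P\in\mathbf{P}$. $\phi^m_{\mathrm{stack}}$ is the conjunction of: (F1) $\forall x.(\bigvee_{0\le j<m}\neg\mathtt{L}_j(x))\to\exists^{=1}y.\mathtt{F}(x,y)$; (F2) $\forall x.(\bigwedge_{0\le j<m}\mathtt{L}_j(x))\to\exists^{=0}y.\mathtt{F}(x,y)$; (F3) $\forall x.(\bigvee_{0\le j<m}\mathtt{L}_j(x))\to\exists^{=1}y.\mathtt{F}(y,x)$; (F4) $\forall x.(\bigwedge_{0\le j<m}\neg\mathtt{L}_j(x))\to\exists^{=0}y.\mathtt{F}(y,x)$; (F5) $\forall x\forall y.\mathtt{F}(x,y)\to\bigwedge_{0\le j<m}\big((\mathtt{L}_j(x)\leftrightarrow\mathtt{L}_j(y))\leftrightarrow\bigvee_{0\le j'<j}\neg\mathtt{L}_{j'}(x)\big)$; (F6) for every binary $P\in\mathbf{P}$: $\forall x\forall y.P(x,y)\to\bigwedge_{0\le j<m}(\mathtt{L}_j(x)\leftrightarrow\mathtt{L}_j(y))$. Here $\exists^{=k}$ means "exactly $k$". *)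

theory Defs
  imports Main
begin

text \<open>Relational signatures with unary and binary predicate symbols and no constants. The symbols
  of a signature are subsets of types, so that either kind may be empty.\<close>

record ('u, 'b) signature =
  unary_syms :: "'u set"
  binary_syms :: "'b set"

record ('u, 'b, 'd) interp =
  Dom :: "'d set"
  Unary :: "'u \<Rightarrow> 'd set"
  Binary :: "'b \<Rightarrow> ('d \<times> 'd) set"

text \<open>The values of \<^const>\<open>Unary\<close> and \<^const>\<open>Binary\<close> at symbols outside the signature are unconstrained
  and play no role: isomorphism below ignores them too.\<close>

definition interpretation_over ::
  "('u, 'b) signature \<Rightarrow> ('u, 'b, 'd) interp \<Rightarrow> bool" where
  "interpretation_over \<Sigma> I \<longleftrightarrow>
     Dom I \<noteq> {} \<and>
     (\<forall>P \<in> unary_syms \<Sigma>. Unary I P \<subseteq> Dom I) \<and>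
     (\<forall>P \<in> binary_syms \<Sigma>. Binary I P \<subseteq> Dom I \<times> Dom I)"

definition isomorphism ::
  "('u, 'b) signature \<Rightarrow> ('d \<Rightarrow> 'e) \<Rightarrow> ('u, 'b, 'd) interp \<Rightarrow> ('u, 'b, 'e) interp \<Rightarrow> bool" where
  "isomorphism \<Sigma> h I J \<longleftrightarrow>
     bij_betw h (Dom I) (Dom J) \<and>
     (\<forall>P \<in> unary_syms \<Sigma>. \<forall>x \<in> Dom I. x \<in> Unary I P \<longleftrightarrow> h x \<in> Unary J P) \<and>
     (\<forall>P \<in> binary_syms \<Sigma>. \<forall>x \<in> Dom I. \<forall>y \<in> Dom I. (x, y) \<in> Binary I P \<longleftrightarrow> (h x, h y) \<in> Binary J P)"

definition isomorphic ::
  "('u, 'b) signature \<Rightarrow> ('u, 'b, 'd) interp \<Rightarrow> ('u, 'b, 'e) interp \<Rightarrow> bool" where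
  "isomorphic \<Sigma> I J \<longleftrightarrow> (\<exists>h. isomorphism \<Sigma> h I J)"


text \<open>First-order formulas with counting quantifiers; \<open>Exactly k x \<phi>\<close> is $\exists^{=k} x.\ \phi$.
  The empty \<open>Conj\<close> is true and the empty \<open>Disj\<close> is false.\<close>

type_synonym var = nat

datatype ('u, 'b) fm =
    UAtom 'u var
  | BAtom 'b var var
  | Equal var var
  | Neg "('u, 'b) fm"
  | Conj "('u, 'b) fm list"
  | Disj "('u, 'b) fm list"
  | Imp "('u, 'b) fm" "('u, 'b) fm"
  | Iff "('u, 'b) fm" "('u, 'b) fm"
  | Forall var "('u, 'b) fm"
  | Exists var "('u, 'b) fm"
  | Exactly nat var "('u, 'b) fm"

text \<open>The finiteness condition for \<open>Exactly\<close> matters because infinite sets have \<^const>\<open>card\<close> 0.\<close>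

fun sat :: "('u, 'b, 'd) interp \<Rightarrow> (var \<Rightarrow> 'd) \<Rightarrow> ('u, 'b) fm \<Rightarrow> bool" where
  "sat I v (UAtom P x) \<longleftrightarrow> v x \<in> Unary I P"
| "sat I v (BAtom P x y) \<longleftrightarrow> (v x, v y) \<in> Binary I P"
| "sat I v (Equal x y) \<longleftrightarrow> v x = v y"
| "sat I v (Neg \<phi>) \<longleftrightarrow> \<not> sat I v \<phi>"
| "sat I v (Conj \<phi>s) \<longleftrightarrow> (\<forall>\<phi> \<in> set \<phi>s. sat I v \<phi>)"
| "sat I v (Disj \<phi>s) \<longleftrightarrow> (\<exists>\<phi> \<in> set \<phi>s. sat I v \<phi>)"
| "sat I v (Imp \<phi> \<psi>) \<longleftrightarrow> (sat I v \<phi> \<longrightarrow> sat I v \<psi>)"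
| "sat I v (Iff \<phi> \<psi>) \<longleftrightarrow> (sat I v \<phi> \<longleftrightarrow> sat I v \<psi>)"
| "sat I v (Forall x \<phi>) \<longleftrightarrow> (\<forall>d \<in> Dom I. sat I (v(x := d)) \<phi>)"
| "sat I v (Exists x \<phi>) \<longleftrightarrow> (\<exists>d \<in> Dom I. sat I (v(x := d)) \<phi>)"
| "sat I v (Exactly k x \<phi>) \<longleftrightarrow>
     finite {d \<in> Dom I. sat I (v(x := d)) \<phi>} \<and> card {d \<in> Dom I. sat I (v(x := d)) \<phi>} = k"

text \<open>Satisfaction of the (possibly infinite) conjunction of a set of sentences.\<close>

definition satisfies :: "('u, 'b, 'd) interp \<Rightarrow> ('u, 'b) fm set \<Rightarrow> bool" where
  "satisfies I \<Phi> \<longleftrightarrow> (\<forall>\<phi> \<in> \<Phi>. \<forall>v. range v \<subseteq> Dom I \<longrightarrow> sat I v \<phi>)"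


text \<open>Standpoint structures over a vocabulary with predicates \<open>\<Sigma>\<close>, no constants, and the universal
  standpoint as the only standpoint symbol.\<close>

datatype standpoint = Star

record ('u, 'b, 'd, 'w) standpoint_structure =
  domain :: "'d set"
  precisifications :: "'w set"
  sigma :: "standpoint \<Rightarrow> 'w set"
  gamma :: "'w \<Rightarrow> ('u, 'b, 'd) interp"

definition standpoint_structure_over ::
  "('u, 'b) signature \<Rightarrow> ('u, 'b, 'd, 'w) standpoint_structure \<Rightarrow> bool" where
  "standpoint_structure_over \<Sigma> M \<longleftrightarrow>
     domain M \<noteq> {} \<and>
     precisifications M \<noteq> {} \<and>
     sigma M Star = precisifications M \<and>
     (\<forall>p \<in> precisifications M.
        interpretation_over \<Sigma> (gamma M p) \<and> Dom (gamma M p) = domain M)"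


datatype 'u stack_unary = Base1 'u | L nat
datatype 'b stack_binary = Base2 'b | F

definition stack_signature ::
  "nat \<Rightarrow> ('u, 'b) signature \<Rightarrow> ('u stack_unary, 'b stack_binary) signature" where
  "stack_signature m \<Sigma> =
     \<lparr> unary_syms = Base1 ` unary_syms \<Sigma> \<union> L ` {..<m},
       binary_syms = insert F (Base2 ` binary_syms \<Sigma>) \<rparr>"

text \<open>The linear order on the precisifications is given by an enumeration.\<close>

definition enumerates :: "nat \<Rightarrow> (nat \<Rightarrow> 'w) \<Rightarrow> 'w set \<Rightarrow> bool" where
  "enumerates m e W \<longleftrightarrow> bij_betw e {..<2 ^ m} W"

definition stacked ::
  "nat \<Rightarrow> ('u, 'b, 'd, 'w) standpoint_structure \<Rightarrow> (nat \<Rightarrow> 'w) \<Rightarrow>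
   ('u stack_unary, 'b stack_binary, 'd \<times> nat) interp" where
  "stacked m M e =
     \<lparr> Dom = domain M \<times> {..<2 ^ m},
       Unary = (\<lambda>P. case P of
               Base1 P \<Rightarrow> (\<Union>i<2 ^ m. Unary (gamma M (e i)) P \<times> {i})
             | L j \<Rightarrow> {(d, i). d \<in> domain M \<and> i < 2 ^ m \<and> bit i j}),
       Binary = (\<lambda>P. case P of
                Base2 P \<Rightarrow> {((d1, i), (d2, i)) | d1 d2 i. i < 2 ^ m \<and> (d1, d2) \<in> Binary (gamma M (e i)) P}
              | F \<Rightarrow> {((d, i), (d, i + 1)) | d i. d \<in> domain M \<and> i < 2 ^ m - 1}) \<rparr>"


abbreviation (input) X :: var where "X \<equiv> 0"
abbreviation (input) Y :: var where "Y \<equiv> 1"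

definition F1 :: "nat \<Rightarrow> ('u stack_unary, 'b stack_binary) fm" where
  "F1 m = Forall X (Imp (Disj (map (\<lambda>j. Neg (UAtom (L j) X)) [0..<m]))
                        (Exactly 1 Y (BAtom F X Y)))"

definition F2 :: "nat \<Rightarrow> ('u stack_unary, 'b stack_binary) fm" where
  "F2 m = Forall X (Imp (Conj (map (\<lambda>j. UAtom (L j) X) [0..<m]))
                        (Exactly 0 Y (BAtom F X Y)))"

definition F3 :: "nat \<Rightarrow> ('u stack_unary, 'b stack_binary) fm" where
  "F3 m = Forall X (Imp (Disj (map (\<lambda>j. UAtom (L j) X) [0..<m]))
                        (Exactly 1 Y (BAtom F Y X)))"

definition F4 :: "nat \<Rightarrow> ('u stack_unary, 'b stack_binary) fm" where
  "F4 m = Forall X (Imp (Conj (map (\<lambda>j. Neg (UAtom (L j) X)) [0..<m]))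
                        (Exactly 0 Y (BAtom F Y X)))"

definition F5 :: "nat \<Rightarrow> ('u stack_unary, 'b stack_binary) fm" where
  "F5 m = Forall X (Forall Y (Imp (BAtom F X Y)
            (Conj (map (\<lambda>j. Iff (Iff (UAtom (L j) X) (UAtom (L j) Y))
                                (Disj (map (\<lambda>j'. Neg (UAtom (L j') X)) [0..<j])))
                       [0..<m]))))"

definition F6 :: "nat \<Rightarrow> 'b \<Rightarrow> ('u stack_unary, 'b stack_binary) fm" where
  "F6 m P = Forall X (Forall Y (Imp (BAtom (Base2 P) X Y)
              (Conj (map (\<lambda>j. Iff (UAtom (L j) X) (UAtom (L j) Y)) [0..<m]))))"

text \<open>The conjunction is given by the set of its conjuncts, as the signature may have infinitely
  many binary predicates.\<close>

definition phi_stack ::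
  "nat \<Rightarrow> ('u, 'b) signature \<Rightarrow> ('u stack_unary, 'b stack_binary) fm set" where
  "phi_stack m \<Sigma> = {F1 m, F2 m, F3 m, F4 m, F5 m} \<union> F6 m ` binary_syms \<Sigma>"

definition isomorphic_to_stack_of ::
  "nat \<Rightarrow> ('u, 'b) signature \<Rightarrow> ('u stack_unary, 'b stack_binary, 'a) interp \<Rightarrow>
   ('u, 'b, 'd, 'w) standpoint_structure \<Rightarrow> bool" where
  "isomorphic_to_stack_of m \<Sigma> I M \<longleftrightarrow>
     standpoint_structure_over \<Sigma> M \<and>
     card (precisifications M) = 2 ^ m \<and>
     (\<exists>e. enumerates m e (precisifications M) \<and>
          isomorphic (stack_signature m \<Sigma>) I (stacked m M e))"

end

theory Submission
  imports Defs
begin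

text \<open>The predicates \<open>L j\<close> encode a number, the \<^emph>\<open>level\<close>, at each element. By (F2) and (F5) an
  \<open>F\<close>-edge increases the level by exactly one without overflow, and (F1), (F3) then split the domain
  into disjoint \<open>F\<close>-chains, each meeting every level \<open>0, \<dots>, 2 ^ m - 1\<close> exactly once. An element is
  thus determined by its level and by the element of level 0 (the root) at the bottom of its chain,
  so the roots serve as the domain and the levels as the precisifications. By (F6) binary
  predicates never relate elements of different levels.\<close>

section \<open>Levels and binary arithmetic\<close>

definition level ::
  "nat \<Rightarrow> ('u stack_unary, 'b stack_binary, 'a) interp \<Rightarrow> 'a \<Rightarrow> nat" where
  "level m I x = horner_sum of_bool 2 (map (\<lambda>j. x \<in> Unary I (L j)) [0..<m])"

text \<open>\<open>horner_sum\<close> with base 2 reads its list least significant digit first, so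
  \<open>L j\<close> gets weight \<open>2 ^ j\<close>.\<close>

lemma bit_level_iff: "bit (level m I x) j \<longleftrightarrow> j < m \<and> x \<in> Unary I (L j)"
  by (auto simp: level_def bit_horner_sum_bit_iff)

lemma level_less: "level m I x < 2 ^ m"
proof -
  have "level m I x = take_bit m (level m I x)"
    by (intro bit_eqI) (auto simp: level_def bit_horner_sum_bit_iff bit_take_bit_iff)
  then show ?thesis
    using take_bit_nat_less_exp[of m "level m I x"] by simp
qed

text \<open>Main tool for identifying levels: in contrast to \<open>bit_eqI\<close>, only the
  positions described by the predicates \<open>L j\<close> have to be compared.\<close>

lemma bit_nat_eqI:
  fixes a b :: nat
  assumes "a < 2 ^ m" "b < 2 ^ m" and "\<And>j. j < m \<Longrightarrow> bit a j \<longleftrightarrow> bit b j"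
  shows "a = b"
proof -
  have "take_bit m a = take_bit m b"
    using assms(3) by (intro bit_eqI) (auto simp: bit_take_bit_iff)
  then show ?thesis
    using assms(1,2) by (simp add: take_bit_nat_eq_self)
qed

text \<open>The carry rule behind (F5): adding one flips a bit exactly if all lower bits are 1. The
  induction strips the lowest bit. If it is 0, the carry stops there; if it is 1, the carry passes
  on to \<open>a div 2\<close>.\<close>

lemma bit_Suc_nat_iff:
  "bit (Suc a) j \<longleftrightarrow> (bit a j \<longleftrightarrow> (\<exists>j'<j. \<not> bit a j'))"
proof (induction j arbitrary: a)
  case 0
  then show ?case by (simp add: bit_0)
next
  case (Suc j)
  have ex: "(\<exists>j'<Suc j. \<not> bit a j') \<longleftrightarrow> even a \<or> (\<exists>j'<j. \<not> bit (a div 2) j')"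
    by (auto simp: less_Suc_eq_0_disj bit_0 bit_Suc)
  show ?case
  proof (cases "even a")
    case True
    then have "Suc a div 2 = a div 2" by (elim evenE) simp
    with True ex show ?thesis by (simp add: bit_Suc)
  next
    case False
    then have "Suc a div 2 = Suc (a div 2)" by (elim oddE) simp
    with False ex Suc.IH[of "a div 2"] show ?thesis by (simp add: bit_Suc)
  qed
qed

lemma level_0_iff: "level m I x = 0 \<longleftrightarrow> (\<forall>j<m. x \<notin> Unary I (L j))"
proof
  assume "level m I x = 0"
  then show "\<forall>j<m. x \<notin> Unary I (L j)"
    using bit_level_iff[of m I x] by simp
next
  assume "\<forall>j<m. x \<notin> Unary I (L j)"
  then show "level m I x = 0"
    by (intro bit_nat_eqI[OF level_less]) (auto simp: bit_level_iff)
qed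

lemma level_top_iff: "level m I x = 2 ^ m - 1 \<longleftrightarrow> (\<forall>j<m. x \<in> Unary I (L j))"
proof -
  have mask: "bit (2 ^ m - 1 :: nat) j \<longleftrightarrow> j < m" for j
    using bit_mask_iff[of m j, where 'a = nat] by (simp add: mask_eq_exp_minus_1)
  show ?thesis
  proof
    assume "level m I x = 2 ^ m - 1"
    then show "\<forall>j<m. x \<in> Unary I (L j)"
      using bit_level_iff[of m I x] mask by metis
  next
    assume "\<forall>j<m. x \<in> Unary I (L j)"
    then show "level m I x = 2 ^ m - 1"
      by (intro bit_nat_eqI[OF level_less]) (auto simp: bit_level_iff mask simp del: One_nat_def)
  qed
qed

lemma Suc_level_less_iff:
  "Suc (level m I x) < 2 ^ m \<longleftrightarrow> \<not> (\<forall>j<m. x \<in> Unary I (L j))"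
  using level_less[of m I x] unfolding level_top_iff[symmetric] by linarith

text \<open>By the carry rule, \<open>?step\<close> says that \<open>y\<close> carries the successor
  of the level of \<open>x\<close> modulo \<open>2 ^ m\<close>; \<open>?ntop\<close> rules out the
  wrap-around from the top level to 0.\<close>

lemma level_Suc_iff:
  "level m I y = Suc (level m I x) \<longleftrightarrow>
     \<not> (\<forall>j<m. x \<in> Unary I (L j)) \<and>
     (\<forall>j<m. (x \<in> Unary I (L j) \<longleftrightarrow> y \<in> Unary I (L j)) \<longleftrightarrow> (\<exists>j'<j. x \<notin> Unary I (L j')))"
  (is "_ \<longleftrightarrow> ?ntop \<and> ?step")
proof -
  have step: "?step \<longleftrightarrow> (\<forall>j<m. bit (level m I y) j \<longleftrightarrow> bit (Suc (level m I x)) j)"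
  proof -
    have "(\<exists>j'<j. \<not> bit (level m I x) j') \<longleftrightarrow> (\<exists>j'<j. x \<notin> Unary I (L j'))" if "j < m" for j
      using that by (auto simp: bit_level_iff)
    then show ?thesis
      by (auto simp: bit_Suc_nat_iff bit_level_iff)
  qed
  show ?thesis
  proof
    assume "level m I y = Suc (level m I x)"
    then show "?ntop \<and> ?step"
      using step Suc_level_less_iff[of m I x] level_less[of m I y] by simp
  next
    assume "?ntop \<and> ?step"
    then show "level m I y = Suc (level m I x)"
      using step Suc_level_less_iff[of m I x] by (intro bit_nat_eqI[OF level_less]) auto
  qed
qed

lemma level_eq_iff:
  "level m I x = level m I y \<longleftrightarrow> (\<forall>j<m. x \<in> Unary I (L j) \<longleftrightarrow> y \<in> Unary I (L j))"
proof
  assume "level m I x = level m I y"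
  then show "\<forall>j<m. x \<in> Unary I (L j) \<longleftrightarrow> y \<in> Unary I (L j)"
    using bit_level_iff[of m I x] bit_level_iff[of m I y] by metis
next
  assume "\<forall>j<m. x \<in> Unary I (L j) \<longleftrightarrow> y \<in> Unary I (L j)"
  then show "level m I x = level m I y"
    by (intro bit_nat_eqI[OF level_less level_less]) (auto simp: bit_level_iff)
qed

section \<open>The axioms in terms of levels\<close>

lemma card_eq_1_iff_ex1: "finite A \<and> card A = 1 \<longleftrightarrow> (\<exists>!x. x \<in> A)"
proof -
  have "finite A \<and> card A = 1 \<longleftrightarrow> (\<exists>x. A = {x})"
    by (auto simp: card_1_singleton_iff)
  then show ?thesis by auto
qed

lemma card_eq_0_iff_empty: "finite A \<and> card A = 0 \<longleftrightarrow> A = {}"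
  by auto

text \<open>Both directions of the theorem work with this semantic form only. (F1) and (F3) give the
  first two clauses, (F2), (F4) and (F5) merge into the third, and (F6) gives the last.\<close>

lemma satisfies_phi_stack_iff:
  fixes I :: "('u stack_unary, 'b stack_binary, 'a) interp"
  assumes "Dom I \<noteq> {}"
  shows "satisfies I (phi_stack m \<Sigma>) \<longleftrightarrow>
    (\<forall>x\<in>Dom I. Suc (level m I x) < 2 ^ m \<longrightarrow> (\<exists>!y. y \<in> Dom I \<and> (x, y) \<in> Binary I F)) \<and>
    (\<forall>y\<in>Dom I. 0 < level m I y \<longrightarrow> (\<exists>!x. x \<in> Dom I \<and> (x, y) \<in> Binary I F)) \<and>
    (\<forall>x\<in>Dom I. \<forall>y\<in>Dom I. (x, y) \<in> Binary I F \<longrightarrow> level m I y = Suc (level m I x)) \<and>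
    (\<forall>P\<in>binary_syms \<Sigma>. \<forall>x\<in>Dom I. \<forall>y\<in>Dom I. (x, y) \<in> Binary I (Base2 P) \<longrightarrow>
       level m I x = level m I y)"
  (is "_ \<longleftrightarrow> ?up \<and> ?down \<and> ?edge \<and> ?base")
proof -
  obtain d where "d \<in> Dom I"
    using assms by blast
  \<comment> \<open>The axioms are sentences, so their truth value is independent of
    \<open>v\<close>; one admissible assignment then allows the quantifier over assignments to be
    dropped.\<close>
  then have ex_assignment: "\<exists>v :: var \<Rightarrow> 'a. range v \<subseteq> Dom I"
    by (intro exI[of _ "\<lambda>_. d"]) auto
  have top: "Suc (level m I x) < 2 ^ m \<longleftrightarrow> (\<exists>j<m. x \<notin> Unary I (L j))" for x
    by (simp add: Suc_level_less_iff)
  have bot: "0 < level m I x \<longleftrightarrow> (\<exists>j<m. x \<in> Unary I (L j))" for x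
    using level_0_iff[of m I x] by auto
  have 1: "sat I v (F1 m) \<longleftrightarrow> ?up" for v
    unfolding F1_def top by (simp only: sat.simps card_eq_1_iff_ex1) (auto simp: Bex_def)
  have 2: "sat I v (F2 m) \<longleftrightarrow>
    (\<forall>x\<in>Dom I. \<forall>y\<in>Dom I. (x, y) \<in> Binary I F \<longrightarrow> \<not> (\<forall>j<m. x \<in> Unary I (L j)))" for v
    unfolding F2_def by (simp only: sat.simps card_eq_0_iff_empty) auto
  have 3: "sat I v (F3 m) \<longleftrightarrow> ?down" for v
    unfolding F3_def bot by (simp only: sat.simps card_eq_1_iff_ex1) (auto simp: Bex_def)
  have 4: "sat I v (F4 m) \<longleftrightarrow>
    (\<forall>x\<in>Dom I. \<forall>y\<in>Dom I. (x, y) \<in> Binary I F \<longrightarrow> 0 < level m I y)" for v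
    unfolding F4_def bot by (simp only: sat.simps card_eq_0_iff_empty) fastforce
  have 5: "sat I v (F5 m) \<longleftrightarrow> (\<forall>x\<in>Dom I. \<forall>y\<in>Dom I. (x, y) \<in> Binary I F \<longrightarrow>
      (\<forall>j<m. (x \<in> Unary I (L j) \<longleftrightarrow> y \<in> Unary I (L j)) \<longleftrightarrow> (\<exists>j'<j. x \<notin> Unary I (L j'))))" for v
    unfolding F5_def
    by (simp add: atLeast0LessThan) (simp only: Ball_def Bex_def lessThan_iff)
  have 6: "sat I v (F6 m P) \<longleftrightarrow> (\<forall>x\<in>Dom I. \<forall>y\<in>Dom I.
      (x, y) \<in> Binary I (Base2 P) \<longrightarrow> level m I x = level m I y)" for v P
    unfolding F6_def level_eq_iff
    by (simp add: atLeast0LessThan) (simp only: Ball_def lessThan_iff)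
  have edge: "sat I v (F2 m) \<and> sat I v (F4 m) \<and> sat I v (F5 m) \<longleftrightarrow> ?edge" for v
  proof -
    \<comment> \<open>The three conjuncts are what (F2), (F5) and (F4) say about a single
      \<open>F\<close>-edge.\<close>
    have *: "(\<not> (\<forall>j<m. x \<in> Unary I (L j)) \<and>
        (\<forall>j<m. (x \<in> Unary I (L j) \<longleftrightarrow> y \<in> Unary I (L j)) \<longleftrightarrow> (\<exists>j'<j. x \<notin> Unary I (L j')))) \<and>
        0 < level m I y \<longleftrightarrow> level m I y = Suc (level m I x)" for x y
      unfolding level_Suc_iff[symmetric] by auto
    show ?thesis
      unfolding 2 4 5 *[symmetric] by (simp only: imp_conjR ball_conj_distrib conj_ac)
  qed
  have "satisfies I (phi_stack m \<Sigma>) \<longleftrightarrow>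
    (\<forall>v. range v \<subseteq> Dom I \<longrightarrow> sat I v (F1 m) \<and> sat I v (F3 m) \<and>
      (sat I v (F2 m) \<and> sat I v (F4 m) \<and> sat I v (F5 m)) \<and>
      (\<forall>P\<in>binary_syms \<Sigma>. sat I v (F6 m P)))"
    unfolding satisfies_def phi_stack_def by blast
  also have "\<dots> \<longleftrightarrow> ?up \<and> ?down \<and> ?edge \<and> ?base"
    unfolding edge 1 3 6 by (simp only: ex_assignment all_simps(5) simp_thms)
  finally show ?thesis .
qed

section \<open>Stacked interpretations satisfy the axioms\<close>

lemma stacked_simps:
  "Dom (stacked m M e) = domain M \<times> {..<2 ^ m}"
  "(d, i) \<in> Unary (stacked m M e) (Base1 P) \<longleftrightarrow> i < 2 ^ m \<and> d \<in> Unary (gamma M (e i)) P"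
  "(d, i) \<in> Unary (stacked m M e) (L j) \<longleftrightarrow> d \<in> domain M \<and> i < 2 ^ m \<and> bit i j"
  "((d, i), (d', i')) \<in> Binary (stacked m M e) (Base2 Q) \<longleftrightarrow>
     i = i' \<and> i < 2 ^ m \<and> (d, d') \<in> Binary (gamma M (e i)) Q"
  "((d, i), (d', i')) \<in> Binary (stacked m M e) F \<longleftrightarrow>
     d = d' \<and> d \<in> domain M \<and> i' = Suc i \<and> Suc i < 2 ^ m"
  by (auto simp: stacked_def)

lemma stack_signature_simps:
  "unary_syms (stack_signature m \<Sigma>) = Base1 ` unary_syms \<Sigma> \<union> L ` {..<m}"
  "binary_syms (stack_signature m \<Sigma>) = insert F (Base2 ` binary_syms \<Sigma>)"
  by (simp_all add: stack_signature_def)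

lemma satisfies_phi_stack_if_isomorphic:
  assumes "interpretation_over (stack_signature m \<Sigma>) I"
    and "isomorphic_to_stack_of m \<Sigma> I M"
  shows "satisfies I (phi_stack m \<Sigma>)"
proof -
  obtain e h where iso: "isomorphism (stack_signature m \<Sigma>) h I (stacked m M e)"
    using assms(2) by (auto simp: isomorphic_to_stack_of_def isomorphic_def)
  \<comment> \<open>The coordinates of the isomorphism: the element of \<open>domain M\<close> and
    the index of the precisification.\<close>
  define r where "r = fst \<circ> h"
  define l where "l = snd \<circ> h"
  have h: "h x = (r x, l x)" for x
    by (simp add: r_def l_def)
  have bij: "bij_betw h (Dom I) (domain M \<times> {..<2 ^ m})"
    using iso by (simp add: isomorphism_def stacked_simps)
  have rl: "r x \<in> domain M" "l x < 2 ^ m" if "x \<in> Dom I" for x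
    using bij_betwE[OF bij] that h by auto
  have inj: "x = y" if "r x = r y" "l x = l y" "x \<in> Dom I" "y \<in> Dom I" for x y
    using inj_onD[OF bij_betw_imp_inj_on[OF bij], of x y] that by (simp add: h)
  have surj: "\<exists>x\<in>Dom I. r x = d \<and> l x = i" if "d \<in> domain M" "i < 2 ^ m" for d i
  proof -
    have "(d, i) \<in> h ` Dom I"
      using that bij by (simp add: bij_betw_def)
    then show ?thesis by (auto simp: h)
  qed
  have "x \<in> Unary I (L j) \<longleftrightarrow> bit (l x) j" if "x \<in> Dom I" "j < m" for x j
    using iso that rl[of x]
    by (auto simp: isomorphism_def stack_signature_simps h stacked_simps)
  \<comment> \<open>Since \<open>h\<close> preserves the \<open>L j\<close>, the level read off in
    \<open>I\<close> is the index, and all clauses can be checked on coordinates.\<close>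
  then have level: "level m I x = l x" if "x \<in> Dom I" for x
    using that rl by (intro bit_nat_eqI[OF level_less]) (auto simp: bit_level_iff)
  have edge: "(x, y) \<in> Binary I F \<longleftrightarrow> r x = r y \<and> l y = Suc (l x)"
    if "x \<in> Dom I" "y \<in> Dom I" for x y
    using iso that rl[of x] rl[of y]
    by (auto simp: isomorphism_def stack_signature_simps h stacked_simps)
  have base: "l x = l y"
    if "P \<in> binary_syms \<Sigma>" "x \<in> Dom I" "y \<in> Dom I" "(x, y) \<in> Binary I (Base2 P)" for P x y
    using iso that by (auto simp: isomorphism_def stack_signature_simps h stacked_simps)
  \<comment> \<open>The successor is the preimage of \<open>(r x, Suc (l x))\<close>, a point of the
    stack because of the bound.\<close>
  have up: "\<exists>!y. y \<in> Dom I \<and> (x, y) \<in> Binary I F" if x: "x \<in> Dom I" "Suc (l x) < 2 ^ m" for x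
  proof -
    obtain y where "y \<in> Dom I" "r y = r x" "l y = Suc (l x)"
      using surj[of "r x" "Suc (l x)"] rl x by auto
    then show ?thesis
      using x inj by (intro ex1I[of _ y]) (auto simp: edge)
  qed
  have down: "\<exists>!x. x \<in> Dom I \<and> (x, y) \<in> Binary I F" if y: "y \<in> Dom I" "0 < l y" for y
  proof -
    obtain k where k: "l y = Suc k"
      using y(2) by (auto simp: gr0_conv_Suc)
    then obtain x where "x \<in> Dom I" "r x = r y" "Suc (l x) = l y"
      using surj[of "r y" k] rl[of y] y(1) by auto
    then show ?thesis
      using y inj by (intro ex1I[of _ x]) (auto simp: edge)
  qed
  have "Dom I \<noteq> {}"
    using assms(1) by (simp add: interpretation_over_def)
  then show ?thesis
    unfolding satisfies_phi_stack_iff[OF \<open>Dom I \<noteq> {}\<close>]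
    using up down edge base by (simp add: level)
qed

section \<open>Reconstructing a standpoint structure from a model\<close>

text \<open>The structure is built inside \<open>I\<close>, which explains its types: roots are
  elements of type \<open>'a\<close>, and precisifications are levels.\<close>

lemma isomorphic_stack_if_satisfies_phi_stack:
  fixes I :: "('u stack_unary, 'b stack_binary, 'a) interp"
  assumes I: "interpretation_over (stack_signature m \<Sigma>) I"
    and sat: "satisfies I (phi_stack m \<Sigma>)"
  shows "\<exists>M :: ('u, 'b, 'a, nat) standpoint_structure. isomorphic_to_stack_of m \<Sigma> I M"
proof -
  have ne: "Dom I \<noteq> {}"
    using I by (simp add: interpretation_over_def)
  let ?l = "level m I"
  have up: "\<And>x. x \<in> Dom I \<Longrightarrow> Suc (?l x) < 2 ^ m \<Longrightarrow> \<exists>!y. y \<in> Dom I \<and> (x, y) \<in> Binary I F"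
    and down: "\<And>y. y \<in> Dom I \<Longrightarrow> 0 < ?l y \<Longrightarrow> \<exists>!x. x \<in> Dom I \<and> (x, y) \<in> Binary I F"
    and edge: "\<And>x y. x \<in> Dom I \<Longrightarrow> y \<in> Dom I \<Longrightarrow> (x, y) \<in> Binary I F \<Longrightarrow> ?l y = Suc (?l x)"
    and base: "\<And>P x y. P \<in> binary_syms \<Sigma> \<Longrightarrow> x \<in> Dom I \<Longrightarrow> y \<in> Dom I \<Longrightarrow>
        (x, y) \<in> Binary I (Base2 P) \<Longrightarrow> ?l x = ?l y"
    using sat unfolding satisfies_phi_stack_iff[OF ne] by blast+
  \<comment> \<open>The \<open>F\<close>-predecessor, meaningful only above level 0.\<close>
  define g where "g y = (THE x. x \<in> Dom I \<and> (x, y) \<in> Binary I F)" for y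
  have g: "g y \<in> Dom I" "(g y, y) \<in> Binary I F" if "y \<in> Dom I" "0 < ?l y" for y
    using theI'[OF down[OF that]] unfolding g_def by auto
  \<comment> \<open>Each predecessor step lowers the level by one, so this many steps lead from
    \<open>x\<close> to its root.\<close>
  define r where "r x = (g ^^ ?l x) x" for x
  have g_eq: "g y = x" if "x \<in> Dom I" "y \<in> Dom I" "(x, y) \<in> Binary I F" for x y
    using down[of y] edge[OF that] g[of y] that by auto
  have r_edge: "r y = r x" if "x \<in> Dom I" "y \<in> Dom I" "(x, y) \<in> Binary I F" for x y
    using edge[OF that] g_eq[OF that] by (simp add: r_def funpow_swap1)
  let ?D = "{x \<in> Dom I. ?l x = 0}"
  have r_root: "r x \<in> ?D" if "x \<in> Dom I" "?l x = n" for x n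
    using that
  proof (induction n arbitrary: x)
    case 0
    then show ?case by (simp add: r_def)
  next
    case (Suc n)
    then show ?case
      using g[of x] edge[of "g x" x] r_edge[of "g x" x] by auto
  qed
  \<comment> \<open>Descend from both elements: the predecessors coincide by induction, and
    uniqueness of the successor lifts the equality back up.\<close>
  have inj: "x = y" if "x \<in> Dom I" "y \<in> Dom I" "?l x = n" "?l y = n" "r x = r y" for x y n
    using that
  proof (induction n arbitrary: x y)
    case 0
    then show ?case by (simp add: r_def)
  next
    case (Suc n)
    have gx: "g x \<in> Dom I" "(g x, x) \<in> Binary I F" "?l (g x) = n" "r (g x) = r x"
      using Suc.prems g[of x] edge[of "g x" x] r_edge[of "g x" x] by auto
    have gy: "g y \<in> Dom I" "(g y, y) \<in> Binary I F" "?l (g y) = n" "r (g y) = r y"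
      using Suc.prems g[of y] edge[of "g y" y] r_edge[of "g y" y] by auto
    have "g x = g y"
      using Suc.IH[of "g x" "g y"] Suc.prems gx gy by simp
    moreover have "Suc (?l (g x)) < 2 ^ m"
      using gx Suc.prems level_less[of m I x] by simp
    ultimately show ?case
      using up[of "g x"] gx gy Suc.prems by auto
  qed
  \<comment> \<open>Climb from the root \<open>d\<close> along successors, which exist below the top
    level.\<close>
  have surj: "\<exists>x\<in>Dom I. r x = d \<and> ?l x = i" if "d \<in> ?D" "i < 2 ^ m" for d i
    using that(2)
  proof (induction i)
    case 0
    then show ?case
      using that(1) by (intro bexI[of _ d]) (auto simp: r_def)
  next
    case (Suc i)
    then obtain x where x: "x \<in> Dom I" "r x = d" "?l x = i" by auto
    then obtain y where "y \<in> Dom I" "(x, y) \<in> Binary I F"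
      using up Suc.prems by blast
    then show ?case
      using x edge r_edge by blast
  qed
  have F_iff: "(x, y) \<in> Binary I F \<longleftrightarrow> r x = r y \<and> ?l y = Suc (?l x)"
    if xy: "x \<in> Dom I" "y \<in> Dom I" for x y
  proof
    assume "r x = r y \<and> ?l y = Suc (?l x)"
    \<comment> \<open>Both \<open>g y\<close> and \<open>x\<close> have the root of \<open>y\<close>
      and lie one level below it, so \<open>inj\<close> identifies them.\<close>
    then have "g y = x"
      using xy g[of y] edge[of "g y" y] r_edge[of "g y" y] by (auto intro!: inj[of "g y" x "?l x"])
    then show "(x, y) \<in> Binary I F"
      using g[of y] xy \<open>r x = r y \<and> ?l y = Suc (?l x)\<close> by auto
  qed (use edge r_edge xy in auto)
  \<comment> \<open>The slice of \<open>I\<close> at level \<open>i\<close>, transported to the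
    roots along \<open>r\<close>.\<close>
  define G :: "nat \<Rightarrow> ('u, 'b, 'a) interp" where
    "G i = \<lparr>Dom = ?D,
       Unary = (\<lambda>P. {r x | x. x \<in> Dom I \<and> ?l x = i \<and> x \<in> Unary I (Base1 P)}),
       Binary = (\<lambda>P. {(r x, r y) | x y. x \<in> Dom I \<and> y \<in> Dom I \<and> ?l x = i \<and> ?l y = i \<and>
                   (x, y) \<in> Binary I (Base2 P)})\<rparr>" for i
  define M :: "('u, 'b, 'a, nat) standpoint_structure" where
    "M = \<lparr>domain = ?D, precisifications = {..<2 ^ m}, sigma = (\<lambda>_. {..<2 ^ m}), gamma = G\<rparr>"
  have D_ne: "?D \<noteq> {}"
    using ne r_root by blast
  then have "interpretation_over \<Sigma> (G i)" for i
    using r_root unfolding interpretation_over_def G_def by fastforce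
  then have M: "standpoint_structure_over \<Sigma> M"
    using D_ne by (auto simp: standpoint_structure_over_def M_def G_def lessThan_empty_iff)
  have bij: "bij_betw (\<lambda>x. (r x, ?l x)) (Dom I) (?D \<times> {..<2 ^ m})"
  proof (rule bij_betw_imageI)
    show "inj_on (\<lambda>x. (r x, ?l x)) (Dom I)"
      using inj by (auto intro: inj_onI)
    show "(\<lambda>x. (r x, ?l x)) ` Dom I = ?D \<times> {..<2 ^ m}"
      using r_root level_less[of m I] surj by (fastforce simp: image_iff)
  qed
  \<comment> \<open>On a single level \<open>r\<close> is injective, so passing to the image adds no
    new members.\<close>
  have U: "x \<in> Unary I (Base1 P) \<longleftrightarrow> r x \<in> Unary (G (?l x)) P" if "x \<in> Dom I" for x P
    using that inj by (auto simp: G_def)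
  have B: "(x, y) \<in> Binary I (Base2 P) \<longleftrightarrow> ?l x = ?l y \<and> (r x, r y) \<in> Binary (G (?l x)) P"
    if "x \<in> Dom I" "y \<in> Dom I" "P \<in> binary_syms \<Sigma>" for x y P
  proof
    assume "(x, y) \<in> Binary I (Base2 P)"
    then show "?l x = ?l y \<and> (r x, r y) \<in> Binary (G (?l x)) P"
      \<comment> \<open>Here (F6) enters: related elements share a level, hence a slice.\<close>
      using that base[of P x y] by (auto simp: G_def)
  next
    assume "?l x = ?l y \<and> (r x, r y) \<in> Binary (G (?l x)) P"
    then obtain x' y' where "x' \<in> Dom I" "y' \<in> Dom I" "?l x' = ?l x" "?l y' = ?l y"
      "r x' = r x" "r y' = r y" and edge': "(x', y') \<in> Binary I (Base2 P)"
      by (auto simp: G_def)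
    then have "x' = x" "y' = y"
      using that inj by blast+
    with edge' show "(x, y) \<in> Binary I (Base2 P)"
      by simp
  qed
  have "isomorphism (stack_signature m \<Sigma>) (\<lambda>x. (r x, ?l x)) I (stacked m M id)"
    unfolding isomorphism_def stack_signature_simps
  proof (intro conjI ballI)
    show "bij_betw (\<lambda>x. (r x, ?l x)) (Dom I) (Dom (stacked m M id))"
      using bij by (simp add: stacked_simps M_def)
  next
    fix P x
    assume "P \<in> Base1 ` unary_syms \<Sigma> \<union> L ` {..<m}" and x: "x \<in> Dom I"
    then show "x \<in> Unary I P \<longleftrightarrow> (r x, ?l x) \<in> Unary (stacked m M id) P"
    proof (elim UnE imageE)
      fix p
      assume "P = Base1 p"
      then show ?thesis
        using U[OF x, of p] level_less[of m I x] by (simp add: stacked_simps M_def)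
    next
      fix j
      assume "P = L j" "j \<in> {..<m}"
      then show ?thesis
        using r_root[OF x refl] level_less[of m I x]
        by (simp add: stacked_simps M_def bit_level_iff)
    qed
  next
    fix P x y
    assume "P \<in> insert F (Base2 ` binary_syms \<Sigma>)" and xy: "x \<in> Dom I" "y \<in> Dom I"
    then show "(x, y) \<in> Binary I P \<longleftrightarrow>
        ((r x, ?l x), (r y, ?l y)) \<in> Binary (stacked m M id) P"
    proof (elim insertE imageE)
      assume "P = F"
      then show ?thesis
        using F_iff[OF xy] r_root[OF xy(1) refl] level_less[of m I y]
        by (auto simp: stacked_simps M_def)
    next
      fix p
      assume "P = Base2 p" "p \<in> binary_syms \<Sigma>"
      then show ?thesis
        using B[OF xy, of p] level_less[of m I x] by (simp add: stacked_simps M_def)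
    qed
  qed
  moreover have "enumerates m id (precisifications M)"
    by (simp add: enumerates_def M_def)
  moreover have "card (precisifications M) = 2 ^ m"
    by (simp add: M_def)
  ultimately have "isomorphic_to_stack_of m \<Sigma> I M"
    using M unfolding isomorphic_to_stack_of_def isomorphic_def by blast
  then show ?thesis by blast
qed

text \<open>An existential statement in HOL cannot range over types. The equivalence therefore names
  the types of the constructed structure, while the second conjunct gives the converse for
  structures over arbitrary types.\<close>

theorem theorem5:
  fixes m :: nat
    and \<Sigma> :: "('u, 'b) signature"
    and I :: "('u stack_unary, 'b stack_binary, 'a) interp"
  assumes "interpretation_over (stack_signature m \<Sigma>) I"
  shows "(satisfies I (phi_stack m \<Sigma>) \<longleftrightarrow>
            (\<exists>M :: ('u, 'b, 'a, nat) standpoint_structure. isomorphic_to_stack_of m \<Sigma> I M)) \<and>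
         (\<forall>M :: ('u, 'b, 'd, 'w) standpoint_structure.
            isomorphic_to_stack_of m \<Sigma> I M \<longrightarrow> satisfies I (phi_stack m \<Sigma>))"
proof (intro conjI iffI allI impI)
  assume "satisfies I (phi_stack m \<Sigma>)"
  then show "\<exists>M :: ('u, 'b, 'a, nat) standpoint_structure. isomorphic_to_stack_of m \<Sigma> I M"
    by (rule isomorphic_stack_if_satisfies_phi_stack[OF assms])
qed (auto intro: satisfies_phi_stack_if_isomorphic[OF assms])

end
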